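(* Let $\vec\mu=(\mu_1,\mu_2)$ be a perfect system of measures on the real line, let $\vec N\in\mathbb N^2$ and $\vec\kappa\in\mathbb R^2$ with $\kappa_1+\kappa_2=1$, and assume that: (i) for every $Y\in\mathcal V_{\vec N}\cup\{O_{(p)}\}$ all zeros of $P_{\Pi(Y)}$ are real and simple, i.e. $E_{\Pi(Y)}\subset\mathbb R$ and $\#E_{\Pi(Y)}=|\Pi(Y)|$ (with $|\Pi(O_{(p)})|:=|\vec N|+1$); (ii) $E_{\Pi(Y)}\cap E_{\Pi(Y_{(p)})}=\varnothing$ for every $Y\in\mathcal V_{\vec N}$. Let $\mathcal J_{\vec\kappa,\vec N}$ be the corresponding Jacobi matrix on the finite tree $\mathcal T_{\vec N}$. Then $$\sigma(\mathcal J_{\vec\kappa,\vec N})=\mathcal E_{\vec\kappa,\vec N}.$$ For each $E\in\sigma(\mathcal J_{\vec\kappa,\vec N})$, the set $\{b(E,X):X\in\mathrm{Joint}^*(E)\}$ is a basis of the eigenspace of $\mathcal J_{\vec\kappa,\vec N}$ corresponding to $E$, and the geometric multiplicity $g_E$ of $E$ equals $\#\mathrm{Joint}^*(E)$. Moreover, the system $$\{b(E,X):X\in\mathrm{Joint}^*(E),\ E\in\sigma(\mathcal J_{\vec\kappa,\vec N})\}$$ is a basis of $\ell^2(\mathcal V_{\vec N})$.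
   Context: Multiple orthogonality. $\vec\mu=(\mu_1,\mu_2)$ is a pair of positive Borel measures on $\mathbb R$ with all moments finite. For $\vec n=(n_1,n_2)\in\mathbb Z_+^2$, $|\vec n|=n_1+n_2$, a type II multiple orthogonal polynomial is a nonzero polynomial $P_{\vec n}$ with $\deg P_{\vec n}\le|\vec n|$ and $\int P_{\vec n}(x)x^m\,d\mu_k(x)=0$ for $0\le m\le n_k-1$, $k\in\{1,2\}$. The index $\vec n$ is normal if every such $P_{\vec n}$ has degree exactly $|\vec n|$; then $P_{\vec n}$ is taken monic. The system $\vec\mu$ is perfect if all $\vec n\in\mathbb Z_+^2$ are normal. For perfect systems there are real recurrence coefficients $a_{\vec n,i},b_{\vec n,i}$ with $$xP_{\vec n}=P_{\vec n+\vec e_i}+b_{\vec n,i}P_{\vec n}+a_{\vec n,1}P_{\vec n-\vec e_1}+a_{\vec n,2}P_{\vec n-\vec e_2},\quad \vec n\in\mathbb Z_+^2,\ i\in\{1,2\},$$ where $\vec e_1=(1,0)$, $\vec e_2=(0,1)$, $P_{\vec n-\vec e_l}:=0$ if the index has a negative component, and $a_{(0,n),1}=a_{(n,0),2}:=0$; one has $a_{\vec n,i}\ne0$ whenever $n_i>0$. Finite tree. For $\vec N\in\mathbb N^2$, the vertices of the rooted tree $\mathcal T_{\vec N}$ are all finite lattice paths in $\mathbb Z_+^2$ starting at $\vec N$, each step subtracting $\vec e_1$ or $\vec e_2$; the root $O$ is the trivial path, and the children of a path are its one-step extensions. $\mathcal V_{\vec N}$ is the vertex set, $\Pi(Y)\in\mathbb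 Z_+^2$ is the endpoint of the path $Y$, $Y_{(p)}$ is the parent of $Y\neq O$, $\iota_Y\in\{1,2\}$ is defined by $\Pi(Y_{(p)})=\Pi(Y)+\vec e_{\iota_Y}$, and $Y_{(ch),i}$ is the child $Z$ of $Y$ with $\iota_Z=i$; it exists iff the $i$-th coordinate of $\Pi(Y)$ is positive. $ch(Y)$ is the set of those $i$ for which $Y_{(ch),i}$ exists. $\mathcal T_{\vec N[Z]}$ is the subtree consisting of $Z$ and all its descendants, and $\chi_{\mathcal B}$ is the characteristic function of $\mathcal B$. A formal parent $O_{(p)}\notin\mathcal V_{\vec N}$ of $O$ is introduced; all functions $f$ on $\mathcal V_{\vec N}$ are extended by $f_{O_{(p)}}=0$. $\ell^2(\mathcal V_{\vec N})$ is the space of all functions on $\mathcal V_{\vec N}$. Jacobi matrix. $V_O=\kappa_1b_{\vec N,1}+\kappa_2b_{\vec N,2}$, $W_O=1$, and for $Y\ne O$: $V_Y=b_{\Pi(Y),\iota_Y}$, $W_Y=|a_{\Pi(Y_{(p)}),\iota_Y}|>0$; $\sigma_O=0$ and $\sigma_Y\in\{0,1\}$ is such that $(-1)^{\sigma_Y}W_Y=a_{\Pi(Y_{(p)}),\iota_Y}$. Then $$(\mathcal J_{\vec\kappa,\vec N}f)_Y=V_Yf_Y+W_Y^{1/2}f_{Y_{(p)}}+\sum_{l\in ch(Y)}(-1)^{\sigma_{Y_{(ch),l}}}W_{Y_{(ch),l}}^{1/2}f_{Y_{(ch),l}}.$$ Polynomials on the tree. $P_Y=P_{\Pi(Y)}$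 and $p_Y(z)=m_Y^{-1}P_{\Pi(Y)}(z)$ for $Y\in\mathcal V_{\vec N}$, where $m_Y=\prod_{Z\in\mathrm{path}(Y,O)}W_Z^{-1/2}$ (path from $Y$ to $O$ including both ends); $p(E)$ denotes the function $Y\mapsto p_Y(E)$. Formally $P_{\Pi(O_{(p)})}:=\kappa_1P_{\vec N+\vec e_1}+\kappa_2P_{\vec N+\vec e_2}$. $E_{\Pi(Y)}$ is the set of zeros of $P_{\Pi(Y)}$, $Y\in\mathcal V_{\vec N}\cup\{O_{(p)}\}$. Joints and canonical eigenvectors. $$\mathcal E_{\vec\kappa,\vec N}=E_{\Pi(O_{(p)})}\cup\bigcup_{Y\in\mathcal V_{\vec N}:\,\#ch(Y)=2}E_{\Pi(Y)}.$$ For $E\in\mathcal E_{\vec\kappa,\vec N}$: $\mathrm{Joint}(E)=\{Y\in\mathcal V_{\vec N}:P_Y(E)=0,\ \#ch(Y)=2\}$; $\mathrm{Joint}^*(E)=\mathrm{Joint}(E)$ if $E\notin E_{\Pi(O_{(p)})}$ and $\mathrm{Joint}^*(E)=\mathrm{Joint}(E)\cup\{O_{(p)}\}$ if $E\in E_{\Pi(O_{(p)})}$. Put $b(E,O_{(p)})=p(E)$ and, for $X\in\mathrm{Joint}(E)$, $$b(E,X)=p(E)\left(\frac{(-1)^{\sigma_{X_{(ch),2}}}\chi_{\mathcal T_{\vec N[X_{(ch),2}]}}}{W_{X_{(ch),2}}^{1/2}\,p_{X_{(ch),2}}(E)}-\frac{(-1)^{\sigma_{X_{(ch),1}}}\chi_{\mathcal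 T_{\vec N[X_{(ch),1}]}}}{W_{X_{(ch),1}}^{1/2}\,p_{X_{(ch),1}}(E)}\right)$$ (the denominators are nonzero by assumption (ii)). *)

theory Defs
  imports "HOL-Analysis.Analysis" "HOL-Computational_Algebra.Polynomial"
    "HOL-Library.Function_Algebras" "HOL-Library.Sublist"
begin

section \<open>Multiple orthogonality\<close>

text \<open>
  The index set \<open>{1, 2}\<close> is the two-element type \<^typ>\<open>2\<close>, multi-indices are elements of
  \<^typ>\<open>nat ^ 2\<close>, and \<open>axis i 1\<close> is the standard basis vector \<open>e\<^sub>i\<close>.
\<close>

definition moment_system :: "(2 \<Rightarrow> real measure) \<Rightarrow> bool" where
  "moment_system \<mu> \<longleftrightarrow>
     (\<forall>k. sets (\<mu> k) = sets borel \<and> (\<forall>m::nat. integrable (\<mu> k) (\<lambda>x. x ^ m)))"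

definition msize :: "nat ^ 2 \<Rightarrow> nat" where
  "msize n = (\<Sum>i\<in>UNIV. n $ i)"

definition type_II :: "(2 \<Rightarrow> real measure) \<Rightarrow> nat ^ 2 \<Rightarrow> real poly \<Rightarrow> bool" where
  "type_II \<mu> n P \<longleftrightarrow> P \<noteq> 0 \<and> degree P \<le> msize n \<and>
     (\<forall>k. \<forall>m < n $ k. (\<integral>x. poly P x * x ^ m \<partial>\<mu> k) = 0)"

definition normal_index :: "(2 \<Rightarrow> real measure) \<Rightarrow> nat ^ 2 \<Rightarrow> bool" where
  "normal_index \<mu> n \<longleftrightarrow> (\<forall>P. type_II \<mu> n P \<longrightarrow> degree P = msize n)"

definition perfect_system :: "(2 \<Rightarrow> real measure) \<Rightarrow> bool" where
  "perfect_system \<mu> \<longleftrightarrow> (\<forall>n. normal_index \<mu> n)"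

definition mop :: "(2 \<Rightarrow> real measure) \<Rightarrow> nat ^ 2 \<Rightarrow> real poly" where
  "mop \<mu> n = (THE P. type_II \<mu> n P \<and> lead_coeff P = 1)"

definition mop_down :: "(2 \<Rightarrow> real measure) \<Rightarrow> nat ^ 2 \<Rightarrow> 2 \<Rightarrow> real poly" where
  "mop_down \<mu> n l = (if n $ l = 0 then 0 else mop \<mu> (n - axis l 1))"

definition nn_recurrence ::
  "(2 \<Rightarrow> real measure) \<Rightarrow> (nat ^ 2 \<Rightarrow> 2 \<Rightarrow> real) \<Rightarrow> (nat ^ 2 \<Rightarrow> 2 \<Rightarrow> real) \<Rightarrow> bool" where
  "nn_recurrence \<mu> a b \<longleftrightarrow>
     (\<forall>n i. [:0, 1:] * mop \<mu> n =
        mop \<mu> (n + axis i 1) + smult (b n i) (mop \<mu> n)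
        + smult (a n 1) (mop_down \<mu> n 1) + smult (a n 2) (mop_down \<mu> n 2)) \<and>
     (\<forall>n l. n $ l = 0 \<longrightarrow> a n l = 0)"

text \<open>
  For a perfect system the coefficients exist and are unique: if \<open>n $ 1\<close> and \<open>n $ 2\<close> are positive,
  \<open>mop \<mu> (n - axis 1 1)\<close> and \<open>mop \<mu> (n - axis 2 1)\<close> are linearly independent.
\<close>

definition rec_coeffs ::
  "(2 \<Rightarrow> real measure) \<Rightarrow> (nat ^ 2 \<Rightarrow> 2 \<Rightarrow> real) \<times> (nat ^ 2 \<Rightarrow> 2 \<Rightarrow> real)" where
  "rec_coeffs \<mu> = (SOME ab. nn_recurrence \<mu> (fst ab) (snd ab))"

definition rec_a :: "(2 \<Rightarrow> real measure) \<Rightarrow> nat ^ 2 \<Rightarrow> 2 \<Rightarrow> real" where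
  "rec_a \<mu> = fst (rec_coeffs \<mu>)"

definition rec_b :: "(2 \<Rightarrow> real measure) \<Rightarrow> nat ^ 2 \<Rightarrow> 2 \<Rightarrow> real" where
  "rec_b \<mu> = snd (rec_coeffs \<mu>)"


section \<open>The finite tree\<close>

text \<open>
  A path starting at \<open>N\<close> is encoded by the list of its steps, the most recent step first:
  \<open>i\<close> stands for subtracting \<open>axis i 1\<close>.  The root is \<open>[]\<close>, the child \<open>Y\<^sub>(\<^sub>c\<^sub>h\<^sub>)\<^sub>,\<^sub>i\<close> of \<open>Y\<close> is
  \<open>i # Y\<close>, and for \<open>Y \<noteq> []\<close> the parent is \<open>tl Y\<close> and \<open>\<iota>\<^sub>Y = hd Y\<close>.  The ancestors of \<open>Y\<close>,
  \<open>Y\<close> included, are the suffixes of \<open>Y\<close>.  Where the formal parent of the root is needed, it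
  is \<^term>\<open>None\<close>, and a genuine vertex \<open>Y\<close> is \<open>Some Y\<close>.
\<close>

primrec endpoint :: "nat ^ 2 \<Rightarrow> 2 list \<Rightarrow> nat ^ 2" where
  "endpoint N [] = N"
| "endpoint N (i # Y) = endpoint N Y - axis i 1"

inductive_set verts :: "nat ^ 2 \<Rightarrow> 2 list set" for N where
  root: "[] \<in> verts N"
| step: "Y \<in> verts N \<Longrightarrow> endpoint N Y $ i > 0 \<Longrightarrow> i # Y \<in> verts N"

definition ch :: "nat ^ 2 \<Rightarrow> 2 list \<Rightarrow> 2 set" where
  "ch N Y = {i. i # Y \<in> verts N}"

primrec parent :: "2 list \<Rightarrow> 2 list option" where
  "parent [] = None"
| "parent (i # Y) = Some Y"

definition subtree :: "nat ^ 2 \<Rightarrow> 2 list \<Rightarrow> 2 list set" where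
  "subtree N Z = {Y \<in> verts N. suffix Z Y}"


section \<open>Functions on the vertices\<close>

text \<open>Functions on the vertex set are total functions that vanish off it.\<close>

definition l2_verts :: "nat ^ 2 \<Rightarrow> (2 list \<Rightarrow> complex) set" where
  "l2_verts N = {f. \<forall>Y. Y \<notin> verts N \<longrightarrow> f Y = 0}"

definition scale_fun :: "complex \<Rightarrow> ('a \<Rightarrow> complex) \<Rightarrow> 'a \<Rightarrow> complex" where
  "scale_fun c f = (\<lambda>x. c * f x)"

interpretation cfun: vector_space "scale_fun :: complex \<Rightarrow> ('a \<Rightarrow> complex) \<Rightarrow> 'a \<Rightarrow> complex"
  by unfold_locales (auto simp: scale_fun_def fun_eq_iff algebra_simps)

definition is_basis :: "('a \<Rightarrow> complex) set \<Rightarrow> ('a \<Rightarrow> complex) set \<Rightarrow> bool" where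
  "is_basis B S \<longleftrightarrow> cfun.independent B \<and> cfun.span B = S"

definition ext_parent :: "(2 list \<Rightarrow> complex) \<Rightarrow> 2 list option \<Rightarrow> complex" where
  "ext_parent f X = (case X of None \<Rightarrow> 0 | Some Y \<Rightarrow> f Y)"


section \<open>The Jacobi matrix\<close>

primrec V_coeff :: "(2 \<Rightarrow> real measure) \<Rightarrow> real ^ 2 \<Rightarrow> nat ^ 2 \<Rightarrow> 2 list \<Rightarrow> real" where
  "V_coeff \<mu> \<kappa> N [] = \<kappa> $ 1 * rec_b \<mu> N 1 + \<kappa> $ 2 * rec_b \<mu> N 2"
| "V_coeff \<mu> \<kappa> N (i # Y) = rec_b \<mu> (endpoint N (i # Y)) i"

primrec W_coeff :: "(2 \<Rightarrow> real measure) \<Rightarrow> nat ^ 2 \<Rightarrow> 2 list \<Rightarrow> real" where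
  "W_coeff \<mu> N [] = 1"
| "W_coeff \<mu> N (i # Y) = \<bar>rec_a \<mu> (endpoint N Y) i\<bar>"

primrec sgn_exp :: "(2 \<Rightarrow> real measure) \<Rightarrow> nat ^ 2 \<Rightarrow> 2 list \<Rightarrow> nat" where
  "sgn_exp \<mu> N [] = 0"
| "sgn_exp \<mu> N (i # Y) = (if rec_a \<mu> (endpoint N Y) i < 0 then 1 else 0)"

definition jacobi ::
  "(2 \<Rightarrow> real measure) \<Rightarrow> real ^ 2 \<Rightarrow> nat ^ 2 \<Rightarrow> (2 list \<Rightarrow> complex) \<Rightarrow> 2 list \<Rightarrow> complex" where
  "jacobi \<mu> \<kappa> N f = (\<lambda>Y. if Y \<in> verts N then
       of_real (V_coeff \<mu> \<kappa> N Y) * f Y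
       + of_real (sqrt (W_coeff \<mu> N Y)) * ext_parent f (parent Y)
       + (\<Sum>l\<in>ch N Y. (- 1) ^ sgn_exp \<mu> N (l # Y) * of_real (sqrt (W_coeff \<mu> N (l # Y))) * f (l # Y))
     else 0)"

text \<open>
  The space is finite-dimensional, so an operator on it is invertible as soon as it is bijective.
\<close>

definition jacobi_spectrum :: "(2 \<Rightarrow> real measure) \<Rightarrow> real ^ 2 \<Rightarrow> nat ^ 2 \<Rightarrow> complex set" where
  "jacobi_spectrum \<mu> \<kappa> N =
     {z. \<not> bij_betw (\<lambda>f. jacobi \<mu> \<kappa> N f - scale_fun z f) (l2_verts N) (l2_verts N)}"

definition eigenspace ::
  "(2 \<Rightarrow> real measure) \<Rightarrow> real ^ 2 \<Rightarrow> nat ^ 2 \<Rightarrow> complex \<Rightarrow> (2 list \<Rightarrow> complex) set" where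
  "eigenspace \<mu> \<kappa> N E = {f \<in> l2_verts N. jacobi \<mu> \<kappa> N f = scale_fun E f}"

definition geom_mult :: "(2 \<Rightarrow> real measure) \<Rightarrow> real ^ 2 \<Rightarrow> nat ^ 2 \<Rightarrow> complex \<Rightarrow> nat" where
  "geom_mult \<mu> \<kappa> N E = cfun.dim (eigenspace \<mu> \<kappa> N E)"


section \<open>Polynomials on the tree\<close>

definition tree_poly ::
  "(2 \<Rightarrow> real measure) \<Rightarrow> real ^ 2 \<Rightarrow> nat ^ 2 \<Rightarrow> 2 list option \<Rightarrow> real poly" where
  "tree_poly \<mu> \<kappa> N X = (case X of
       None \<Rightarrow> smult (\<kappa> $ 1) (mop \<mu> (N + axis 1 1)) + smult (\<kappa> $ 2) (mop \<mu> (N + axis 2 1))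
     | Some Y \<Rightarrow> mop \<mu> (endpoint N Y))"

definition tree_size :: "nat ^ 2 \<Rightarrow> 2 list option \<Rightarrow> nat" where
  "tree_size N X = (case X of None \<Rightarrow> msize N + 1 | Some Y \<Rightarrow> msize (endpoint N Y))"

definition cpoly :: "real poly \<Rightarrow> complex \<Rightarrow> complex" where
  "cpoly P z = poly (map_poly of_real P) z"

definition tree_zeros ::
  "(2 \<Rightarrow> real measure) \<Rightarrow> real ^ 2 \<Rightarrow> nat ^ 2 \<Rightarrow> 2 list option \<Rightarrow> complex set" where
  "tree_zeros \<mu> \<kappa> N X = {z. cpoly (tree_poly \<mu> \<kappa> N X) z = 0}"

definition m_coeff :: "(2 \<Rightarrow> real measure) \<Rightarrow> nat ^ 2 \<Rightarrow> 2 list \<Rightarrow> real" where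
  "m_coeff \<mu> N Y = (\<Prod>Z | suffix Z Y. 1 / sqrt (W_coeff \<mu> N Z))"

definition p_fun :: "(2 \<Rightarrow> real measure) \<Rightarrow> nat ^ 2 \<Rightarrow> complex \<Rightarrow> 2 list \<Rightarrow> complex" where
  "p_fun \<mu> N E = (\<lambda>Y. if Y \<in> verts N
     then cpoly (mop \<mu> (endpoint N Y)) E / of_real (m_coeff \<mu> N Y) else 0)"


section \<open>Joints and canonical eigenvectors\<close>

definition energy_set :: "(2 \<Rightarrow> real measure) \<Rightarrow> real ^ 2 \<Rightarrow> nat ^ 2 \<Rightarrow> complex set" where
  "energy_set \<mu> \<kappa> N = tree_zeros \<mu> \<kappa> N None \<union>
     (\<Union>Y \<in> {Y \<in> verts N. card (ch N Y) = 2}. tree_zeros \<mu> \<kappa> N (Some Y))"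

definition joint :: "(2 \<Rightarrow> real measure) \<Rightarrow> nat ^ 2 \<Rightarrow> complex \<Rightarrow> 2 list set" where
  "joint \<mu> N E = {Y \<in> verts N. cpoly (mop \<mu> (endpoint N Y)) E = 0 \<and> card (ch N Y) = 2}"

definition joint_star ::
  "(2 \<Rightarrow> real measure) \<Rightarrow> real ^ 2 \<Rightarrow> nat ^ 2 \<Rightarrow> complex \<Rightarrow> 2 list option set" where
  "joint_star \<mu> \<kappa> N E = Some ` joint \<mu> N E \<union>
     (if E \<in> tree_zeros \<mu> \<kappa> N None then {None} else {})"

definition branch_fun ::
  "(2 \<Rightarrow> real measure) \<Rightarrow> nat ^ 2 \<Rightarrow> complex \<Rightarrow> 2 list \<Rightarrow> 2 list \<Rightarrow> complex" where
  "branch_fun \<mu> N E Z = (\<lambda>Y. (- 1) ^ sgn_exp \<mu> N Z * indicator (subtree N Z) Y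
     / (of_real (sqrt (W_coeff \<mu> N Z)) * p_fun \<mu> N E Z))"

definition b_vec ::
  "(2 \<Rightarrow> real measure) \<Rightarrow> nat ^ 2 \<Rightarrow> complex \<Rightarrow> 2 list option \<Rightarrow> 2 list \<Rightarrow> complex" where
  "b_vec \<mu> N E X = (case X of
       None \<Rightarrow> p_fun \<mu> N E
     | Some X' \<Rightarrow> (\<lambda>Y. p_fun \<mu> N E Y *
         (branch_fun \<mu> N E (2 # X') Y - branch_fun \<mu> N E (1 # X') Y)))"

end

(*
  Since m_Y rescales by sqrt W along each edge, the nearest-neighbour recurrence makes p(E) satisfy
  the eigenvalue equation of the Jacobi matrix everywhere except at the root, where the defect is
  P at the formal parent.  If P_X(E) = 0 at a branching vertex X, the equations in the two subtrees
  below X decouple from the rest of the tree, and the multiples of p(E) on them can be balanced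
  against each other at X.  So every zero of P at a branching vertex or at the formal parent gives
  an eigenvector; for fixed E these are triangular with respect to depth, hence independent.
  The matrix need not be symmetric, so diagonalizability is obtained by counting: all zeros being
  simple, there are |N| + 1 + sum of |Pi(Y)| over the branching Y canonical eigenvectors, and this
  is the number of vertices.
*)

theory Submission imports Defs begin

section \<open>Independent families of functions\<close>

lemma sum_fun_apply: "(\<Sum>i\<in>I. f i) x = (\<Sum>i\<in>I. f i x)"
  by (induction I rule: infinite_finite_induct) auto

text \<open>Indexing the coefficients by \<open>I\<close> rather than by the image yields
  injectivity as well: two equal members would cancel with coefficients 1 and -1.\<close>

lemma independent_family:
  assumes fin: "finite I"
    and ind: "\<And>c. (\<Sum>i\<in>I. scale_fun (c i) (v i)) = 0 \<Longrightarrow> \<forall>i\<in>I. c i = 0"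
  shows "inj_on v I" and "cfun.independent (v ` I)"
proof -
  show inj: "inj_on v I"
  proof (rule inj_onI, rule ccontr)
    fix i j assume ij: "i \<in> I" "j \<in> I" "v i = v j" "i \<noteq> j"
    let ?c = "\<lambda>k. if k = i then 1 else if k = j then - 1 else (0 :: complex)"
    have "(\<Sum>k\<in>I. scale_fun (?c k) (v k)) = (\<Sum>k\<in>{i, j}. scale_fun (?c k) (v k))"
      by (rule sum.mono_neutral_right) (use fin ij in \<open>auto simp: scale_fun_def fun_eq_iff\<close>)
    also have "\<dots> = 0"
      using ij by (simp add: scale_fun_def fun_eq_iff)
    finally have "?c i = 0" using ind[of ?c] ij(1) by blast
    then show False by simp
  qed
  show "cfun.independent (v ` I)"
  proof (rule cfun.independent_if_scalars_zero)
    fix f x assume f: "(\<Sum>x\<in>v ` I. scale_fun (f x) x) = 0" and x: "x \<in> v ` I"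
    have "(\<Sum>i\<in>I. scale_fun (f (v i)) (v i)) = 0"
      using f by (simp add: sum.reindex[OF inj])
    then show "f x = 0" using ind[of "\<lambda>i. f (v i)"] x by auto
  qed (use fin in simp)
qed

text \<open>Among the indices with nonzero coefficient, take one of least rank: at its pivot all
  other surviving vectors vanish, which isolates its coefficient.\<close>

lemma triangular_family:
  fixes v :: "'i \<Rightarrow> 'a \<Rightarrow> complex" and rank :: "'i \<Rightarrow> nat"
  assumes fin: "finite I"
    and piv: "\<And>i. i \<in> I \<Longrightarrow> v i (piv i) \<noteq> 0"
    and tri: "\<And>i j. i \<in> I \<Longrightarrow> j \<in> I \<Longrightarrow> rank i \<le> rank j \<Longrightarrow> i \<noteq> j \<Longrightarrow> v j (piv i) = 0"
    and sum0: "(\<Sum>i\<in>I. scale_fun (c i) (v i)) = 0"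
  shows "\<forall>i\<in>I. c i = 0"
proof (rule ccontr)
  assume "\<not> (\<forall>i\<in>I. c i = 0)"
  then obtain i0 where "i0 \<in> I \<and> c i0 \<noteq> 0" by blast
  then obtain i where i: "i \<in> I \<and> c i \<noteq> 0"
      and min: "\<And>j. j \<in> I \<and> c j \<noteq> 0 \<Longrightarrow> rank i \<le> rank j"
    using ex_has_least_nat[where P = "\<lambda>i. i \<in> I \<and> c i \<noteq> 0" and m = rank] by blast
  have "0 = (\<Sum>j\<in>I. c j * v j (piv i))"
    using fun_cong[OF sum0, of "piv i"] by (simp add: sum_fun_apply scale_fun_def)
  also have "\<dots> = (\<Sum>j\<in>{i}. c j * v j (piv i))"
    by (rule sum.mono_neutral_right) (use fin i min tri in \<open>force+\<close>)
  finally show False using i piv by simp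
qed

lemma additive_homogeneous_sum:
  fixes T :: "('a \<Rightarrow> complex) \<Rightarrow> 'a \<Rightarrow> complex"
  assumes add: "\<And>f g. T (f + g) = T f + T g"
    and scale: "\<And>c f. T (scale_fun c f) = scale_fun c (T f)"
  shows "T (sum f B) = (\<Sum>x\<in>B. T (f x))"
proof -
  have T0: "T 0 = 0" using scale[of 0 0] by simp
  show ?thesis
    by (induction B rule: infinite_finite_induct)
      (simp_all only: sum.infinite sum.empty sum.insert T0 add not_False_eq_True)
qed

text \<open>Eigenspaces for distinct eigenvalues form a direct sum; the \<open>u z\<close> are
  allowed to be zero.\<close>

lemma sum_of_eigenvectors_eq_0:
  fixes T :: "('a \<Rightarrow> complex) \<Rightarrow> 'a \<Rightarrow> complex"
  assumes "finite A"
    and add: "\<And>f g. T (f + g) = T f + T g"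
    and scale: "\<And>c f. T (scale_fun c f) = scale_fun c (T f)"
    and "\<And>z. z \<in> A \<Longrightarrow> T (u z) = scale_fun z (u z)"
    and "sum u A = 0"
  shows "\<forall>z\<in>A. u z = 0"
  using assms(1,4,5)
proof (induction A arbitrary: u rule: finite_induct)
  case (insert a A)
  have T0: "T 0 = 0" using scale[of 0 0] by simp
  have s: "u a + sum u A = 0" using insert.prems(2) insert.hyps by (simp only: sum.insert not_False_eq_True)
  \<comment> \<open>Applying \<open>T\<close> to the zero sum and subtracting \<open>a\<close> times
    that sum removes \<open>u a\<close> and multiplies every other \<open>u z\<close> by the nonzero
    number \<open>z - a\<close>.\<close>
  have "(\<Sum>z\<in>A. scale_fun (z - a) (u z)) = (\<Sum>z\<in>A. scale_fun z (u z)) - scale_fun a (sum u A)"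
    by (simp add: cfun.scale_left_diff_distrib sum_subtractf cfun.scale_sum_right)
  also have "\<dots> = scale_fun a (u a) + (\<Sum>z\<in>A. scale_fun z (u z)) - scale_fun a (u a + sum u A)"
    by (simp add: cfun.scale_right_distrib)
  also have "scale_fun a (u a) + (\<Sum>z\<in>A. scale_fun z (u z)) = T (u a + sum u A)"
    using insert.prems(1) by (simp add: add additive_homogeneous_sum[of T, OF add scale])
  finally have sum0: "(\<Sum>z\<in>A. scale_fun (z - a) (u z)) = 0"
    by (simp only: s T0 cfun.scale_zero_right diff_self)
  have "\<forall>z\<in>A. scale_fun (z - a) (u z) = 0"
    by (rule insert.IH[OF _ sum0])
      (use insert.prems(1) in \<open>simp add: scale mult.commute\<close>)
  then have z: "\<forall>z\<in>A. u z = 0"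
    using insert.hyps(2) by (auto simp: cfun.scale_eq_0_iff)
  have "sum u A = 0" by (rule sum.neutral[OF z])
  then have "u a = 0" using s by (simp only: add_0_right)
  then show ?case using z by blast
qed simp

text \<open>Grouping the double sum by eigenvalue gives elements of distinct eigenspaces with sum
  zero; each group vanishes, and \<open>ind\<close> finishes inside the group.\<close>

lemma independent_eigenvectors:
  fixes T :: "('a \<Rightarrow> complex) \<Rightarrow> 'a \<Rightarrow> complex"
  assumes fin: "finite A" "\<And>z. z \<in> A \<Longrightarrow> finite (I z)"
    and add: "\<And>f g. T (f + g) = T f + T g"
    and scale: "\<And>c f. T (scale_fun c f) = scale_fun c (T f)"
    and eig: "\<And>z i. z \<in> A \<Longrightarrow> i \<in> I z \<Longrightarrow> T (v z i) = scale_fun z (v z i)"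
    and ind: "\<And>z c. z \<in> A \<Longrightarrow> (\<Sum>i\<in>I z. scale_fun (c i) (v z i)) = 0 \<Longrightarrow> \<forall>i\<in>I z. c i = 0"
    and sum0: "(\<Sum>(z, i)\<in>Sigma A I. scale_fun (c (z, i)) (v z i)) = 0"
  shows "\<forall>p\<in>Sigma A I. c p = 0"
proof -
  let ?u = "\<lambda>z. \<Sum>i\<in>I z. scale_fun (c (z, i)) (v z i)"
  have "\<forall>z\<in>A. ?u z = 0"
  proof (rule sum_of_eigenvectors_eq_0[OF fin(1) add scale])
    show "sum ?u A = 0" using sum0 fin by (simp add: sum.Sigma)
    show "T (?u z) = scale_fun z (?u z)" if "z \<in> A" for z
      unfolding additive_homogeneous_sum[of T, OF add scale] cfun.scale_sum_right
      by (rule sum.cong) (use that in \<open>simp_all add: scale eig mult.commute\<close>)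
  qed
  then show ?thesis using ind by fastforce
qed

lemma span_family:
  assumes "finite I" "inj_on v I" "f \<in> cfun.span (v ` I)"
  obtains c where "f = (\<Sum>i\<in>I. scale_fun (c i) (v i))"
proof -
  obtain c where "f = (\<Sum>x\<in>v ` I. scale_fun (c x) x)"
    using assms(3) cfun.span_finite[of "v ` I"] assms(1) by auto
  then show thesis using that[of "\<lambda>i. c (v i)"] by (simp add: sum.reindex[OF assms(2)])
qed

text \<open>The point indicators span, so by exchange no independent set has more than
  \<open>card S\<close> elements; a function outside the span of \<open>B\<close> could be adjoined
  to \<open>B\<close> and break this bound.\<close>

lemma functions_on_finite_set_span:
  fixes B :: "('a \<Rightarrow> complex) set"
  assumes S: "finite S" and B: "cfun.independent B" "B \<subseteq> {f. \<forall>x. x \<notin> S \<longrightarrow> f x = 0}"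
    and card: "card S \<le> card B"
  shows "cfun.span B = {f. \<forall>x. x \<notin> S \<longrightarrow> f x = 0}" (is "_ = ?V")
proof -
  let ?D = "(\<lambda>s x. if x = s then 1 else 0 :: complex) ` S"
  have sub: "cfun.subspace ?V"
    by (auto simp: cfun.subspace_def scale_fun_def)
  have V: "?V \<subseteq> cfun.span ?D"
  proof
    fix f assume f: "f \<in> ?V"
    have "f = (\<Sum>s\<in>S. scale_fun (f s) (\<lambda>x. if x = s then 1 else 0))"
      using f S by (auto simp: fun_eq_iff sum_fun_apply scale_fun_def if_distrib cong: if_cong)
    also have "\<dots> \<in> cfun.span ?D"
      by (intro cfun.span_sum cfun.span_scale cfun.span_base) auto
    finally show "f \<in> cfun.span ?D" .
  qed
  have bound: "finite C \<and> card C \<le> card S" if "cfun.independent C" "C \<subseteq> ?V" for C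
    using cfun.independent_span_bound[of ?D C] that V S card_image_le[OF S]
    by (meson finite_imageI order_trans)
  have "f \<in> cfun.span B" if f: "f \<in> ?V" for f
  proof (rule ccontr)
    assume n: "f \<notin> cfun.span B"
    then have "f \<notin> B" using cfun.span_base by blast
    then have "card (insert f B) = Suc (card B)" using bound[OF B] by simp
    moreover have "cfun.independent (insert f B)" using n B(1) cfun.independent_insertI by blast
    ultimately show False using bound[of "insert f B"] f B(2) card by auto
  qed
  then show ?thesis using cfun.span_minimal[OF B(2) sub] by blast
qed


section \<open>Multiple orthogonal polynomials and their recurrence\<close>

text \<open>\<open>Suc 0\<close> is what the simplifier turns \<open>1 :: nat\<close> into.\<close>

lemma axis_one_nth: "(axis i (Suc 0) :: nat ^ 2) $ j = (if j = i then 1 else 0)"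
  by (simp add: axis_def)

lemma msize_add_axis: "msize (n + axis i 1) = Suc (msize n)"
  by (simp add: msize_def sum.distrib axis_one_nth)

lemma diff_axis_add_axis: "n $ i > 0 \<Longrightarrow> n - axis i 1 + axis i 1 = (n :: nat ^ 2)"
  by (simp add: vec_eq_iff axis_one_nth)

definition pmoment :: "(2 \<Rightarrow> real measure) \<Rightarrow> 2 \<Rightarrow> nat \<Rightarrow> real poly \<Rightarrow> real" where
  "pmoment \<mu> k m P = (\<integral>x. poly P x * x ^ m \<partial>\<mu> k)"

lemma type_II_iff:
  "type_II \<mu> n P \<longleftrightarrow> P \<noteq> 0 \<and> degree P \<le> msize n \<and> (\<forall>k. \<forall>m < n $ k. pmoment \<mu> k m P = 0)"
  by (simp add: type_II_def pmoment_def)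

locale perfect_measures =
  fixes \<mu> :: "2 \<Rightarrow> real measure"
  assumes moments: "moment_system \<mu>" and perfect: "perfect_system \<mu>"
begin

section \<open>Moments of polynomials and normality\<close>

lemma integrable_poly_times_power: "integrable (\<mu> k) (\<lambda>x. poly P x * x ^ m)"
proof -
  have eq: "(\<lambda>x. poly P x * x ^ m) = (\<lambda>x. \<Sum>i\<le>degree P. coeff P i * x ^ (i + m))"
    by (simp add: poly_altdef sum_distrib_right power_add mult.assoc)
  have "integrable (\<mu> k) (\<lambda>x. x ^ j)" for j
    using moments by (simp add: moment_system_def)
  then show ?thesis unfolding eq by simp
qed

lemma pmoment_add: "pmoment \<mu> k m (P + Q) = pmoment \<mu> k m P + pmoment \<mu> k m Q"
  using integrable_poly_times_power by (simp add: pmoment_def distrib_right)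

lemma pmoment_diff: "pmoment \<mu> k m (P - Q) = pmoment \<mu> k m P - pmoment \<mu> k m Q"
  using integrable_poly_times_power by (simp add: pmoment_def left_diff_distrib)

lemma pmoment_smult: "pmoment \<mu> k m (smult c P) = c * pmoment \<mu> k m P"
  by (simp add: pmoment_def mult.assoc)

lemma pmoment_0: "pmoment \<mu> k m 0 = 0"
  by (simp add: pmoment_def)

lemma pmoment_pCons: "pmoment \<mu> k m (pCons 0 P) = pmoment \<mu> k (Suc m) P"
  by (simp add: pmoment_def ac_simps)

lemmas pmoment_simps = pmoment_add pmoment_diff pmoment_smult pmoment_0 pmoment_pCons

text \<open>Normality forces a nonzero type II polynomial to have full degree, so a vanishing top
  coefficient leaves only zero.\<close>

lemma orthogonal_low_degree_eq_0:
  assumes "degree P \<le> msize n" "coeff P (msize n) = 0"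
    and "\<And>k m. m < n $ k \<Longrightarrow> pmoment \<mu> k m P = 0"
  shows "P = 0"
proof (rule ccontr)
  assume "P \<noteq> 0"
  then have "degree P = msize n"
    using assms perfect by (auto simp: perfect_system_def normal_index_def type_II_iff)
  then show False using \<open>P \<noteq> 0\<close> assms(2) by (metis leading_coeff_0_iff)
qed

section \<open>Uniqueness and existence of monic type II polynomials\<close>

definition monic_type_II :: "nat ^ 2 \<Rightarrow> real poly \<Rightarrow> bool" where
  "monic_type_II n P \<longleftrightarrow> type_II \<mu> n P \<and> lead_coeff P = 1"

lemma monic_type_II_D:
  assumes "monic_type_II n P"
  shows "degree P = msize n" "coeff P (msize n) = 1" "m < n $ k \<Longrightarrow> pmoment \<mu> k m P = 0"
proof -
  show d: "degree P = msize n"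
    using assms perfect by (auto simp: monic_type_II_def perfect_system_def normal_index_def)
  then show "coeff P (msize n) = 1" using assms by (simp add: monic_type_II_def)
  show "m < n $ k \<Longrightarrow> pmoment \<mu> k m P = 0"
    using assms by (simp add: monic_type_II_def type_II_iff)
qed

lemma monic_type_II_I:
  assumes "degree P \<le> msize n" "coeff P (msize n) = 1"
    and "\<And>k m. m < n $ k \<Longrightarrow> pmoment \<mu> k m P = 0"
  shows "monic_type_II n P"
proof -
  have "degree P = msize n" using assms(1,2) by (metis le_antisym le_degree zero_neq_one)
  then show ?thesis using assms by (auto simp: monic_type_II_def type_II_iff)
qed

lemma monic_type_II_unique:
  assumes "monic_type_II n P" "monic_type_II n Q"
  shows "P = Q"
proof -
  have "P - Q = 0"
    using monic_type_II_D[OF assms(1)] monic_type_II_D[OF assms(2)]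
    by (intro orthogonal_low_degree_eq_0[of _ n]) (auto simp: pmoment_simps intro: degree_diff_le)
  then show ?thesis by simp
qed

text \<open>Otherwise \<open>P\<close> would satisfy all orthogonality conditions of the next index
  in direction \<open>k\<close> while its degree is too small for that index.\<close>

lemma monic_type_II_next_moment_nz:
  assumes "monic_type_II n P"
  shows "pmoment \<mu> k (n $ k) P \<noteq> 0"
proof
  assume 0: "pmoment \<mu> k (n $ k) P = 0"
  note D = monic_type_II_D[OF assms]
  have "P = 0"
  proof (rule orthogonal_low_degree_eq_0[of _ "n + axis k 1"])
    show "pmoment \<mu> j m P = 0" if "m < (n + axis k 1) $ j" for j m
      using that 0 D(3) by (cases "m < n $ j") (auto simp: axis_one_nth less_Suc_eq split: if_splits)
  qed (use D in \<open>auto simp: msize_add_axis[unfolded One_nat_def] coeff_eq_0\<close>)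
  then show False using D(2) by simp
qed

text \<open>
  The coefficient does not depend on the direction \<open>i\<close> of the step below; this is why the
  recurrences in both directions share the same \<open>a\<close>.
\<close>

definition a_ratio :: "nat ^ 2 \<Rightarrow> real poly \<Rightarrow> (2 \<Rightarrow> real poly) \<Rightarrow> 2 \<Rightarrow> real" where
  "a_ratio n P Q k =
     (if n $ k = 0 then 0 else pmoment \<mu> k (n $ k) P / pmoment \<mu> k (n $ k - 1) (Q k))"

text \<open>Multiplication by x shifts moments by one, so \<open>pCons 0 P\<close> violates
  orthogonality at \<open>n\<close> only in the top moment of each measure. The multiples of
  \<open>Q 1\<close> and \<open>Q 2\<close> repair these, and a multiple of \<open>P\<close>
  produces the additional condition in direction \<open>i\<close>.\<close>

lemma monic_type_II_step:
  assumes P: "monic_type_II n P"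
    and Q: "\<And>k. n $ k > 0 \<Longrightarrow> monic_type_II (n - axis k 1) (Q k)"
    and Q0: "\<And>k. n $ k = 0 \<Longrightarrow> Q k = 0"
  shows "\<exists>b. monic_type_II (n + axis i 1)
    (pCons 0 P - smult (a_ratio n P Q 1) (Q 1) - smult (a_ratio n P Q 2) (Q 2) - smult b P)"
proof -
  define R where "R = pCons 0 P - smult (a_ratio n P Q 1) (Q 1) - smult (a_ratio n P Q 2) (Q 2)"
  define b where "b = pmoment \<mu> i (n $ i) R / pmoment \<mu> i (n $ i) P"
  note PD = monic_type_II_D[OF P] and QD = monic_type_II_D[OF Q]
  have Qsize: "Suc (msize (n - axis k 1)) = msize n" if "n $ k > 0" for k
    using msize_add_axis[of "n - axis k 1" k] diff_axis_add_axis[OF that] by simp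
  have Qdeg: "degree (Q k) \<le> msize n" for k
    using QD(1)[of k] Qsize[of k] Q0[of k] by (cases "n $ k = 0") auto
  \<comment> \<open>The only condition at \<open>n\<close> that \<open>Q k\<close> can fail is the
    moment of order \<open>n $ k - 1\<close> against measure \<open>k\<close>, so the two
    corrections do not interfere.\<close>
  have Qmom: "pmoment \<mu> j m (Q k) = 0" if "m < n $ j" "j \<noteq> k \<or> Suc m < n $ j" for j k m
  proof (cases "n $ k = 0")
    case False
    then show ?thesis using that by (intro QD(3)) (auto simp: axis_one_nth)
  qed (simp add: Q0 pmoment_0)
  have Rmom: "pmoment \<mu> j m R = 0" if m: "m < n $ j" for j m
  proof (cases "Suc m < n $ j")
    case True
    then show ?thesis using m by (simp add: R_def pmoment_simps PD(3) Qmom)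
  next
    case False
    then have eq: "n $ j = Suc m" using m by simp
    then have "pmoment \<mu> j m (Q j) \<noteq> 0"
      using monic_type_II_next_moment_nz[OF Q[of j], of j] by (simp add: axis_one_nth)
    then have a: "a_ratio n P Q j * pmoment \<mu> j m (Q j) = pmoment \<mu> j (Suc m) P"
      using eq by (simp add: a_ratio_def)
    have "j = 1 \<or> j = 2" by (rule exhaust_2)
    then show ?thesis
      using a Qmom[OF m, of 1] Qmom[OF m, of 2] by (auto simp: R_def pmoment_simps)
  qed
  have "monic_type_II (n + axis i 1) (R - smult b P)"
  proof (rule monic_type_II_I)
    have "degree (pCons 0 P) \<le> Suc (msize n)"
      using PD(1) degree_pCons_le[of 0 P] by simp
    moreover have "degree (smult c (Q k)) \<le> Suc (msize n)" for c k
      using degree_smult_le[of c "Q k"] Qdeg[of k] by linarith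
    moreover have "degree (smult c P) \<le> Suc (msize n)" for c
      using degree_smult_le[of c P] PD(1) by linarith
    ultimately show "degree (R - smult b P) \<le> msize (n + axis i 1)"
      unfolding R_def msize_add_axis
      by (intro degree_diff_le)
    show "coeff (R - smult b P) (msize (n + axis i 1)) = 1"
      using Qdeg[of 1] Qdeg[of 2] PD by (simp add: R_def msize_add_axis[unfolded One_nat_def] coeff_eq_0)
    show "pmoment \<mu> k m (R - smult b P) = 0" if "m < (n + axis i 1) $ k" for k m
    proof (cases "m < n $ k")
      case True
      then show ?thesis by (simp add: pmoment_simps Rmom PD(3))
    next
      case False
      then have "k = i" "m = n $ i" using that by (auto simp: axis_one_nth split: if_splits)
      then show ?thesis
        using monic_type_II_next_moment_nz[OF P, of i] by (simp add: pmoment_simps b_def)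
    qed
  qed
  then show ?thesis unfolding R_def by blast
qed

text \<open>Induction on the size: \<open>n\<close> is reached by one step from a smaller index, and
  that step needs only polynomials of smaller size.\<close>

lemma monic_type_II_exists: "\<exists>P. monic_type_II n P"
proof (induction "msize n" arbitrary: n rule: less_induct)
  case less
  show ?case
  proof (cases "n = 0")
    case True
    then have "monic_type_II n 1"
      by (intro monic_type_II_I) (simp_all add: msize_def)
    then show ?thesis ..
  next
    case False
    then obtain i where i: "n $ i > 0" by (auto simp: vec_eq_iff)
    let ?m = "n - axis i 1"
    have n: "n = ?m + axis i 1" using diff_axis_add_axis[OF i] by simp
    have size: "msize n = Suc (msize ?m)" by (subst n) (rule msize_add_axis)
    obtain P where P: "monic_type_II ?m P" using less[of ?m] size by auto
    \<comment> \<open>A neighbour with a negative component is represented by the zero polynomial,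
      matching \<open>mop_down\<close>.\<close>
    have "\<exists>Q. (?m $ k > 0 \<longrightarrow> monic_type_II (?m - axis k 1) Q) \<and> (?m $ k = 0 \<longrightarrow> Q = 0)" for k
    proof (cases "?m $ k = 0")
      case False
      then have "Suc (msize (?m - axis k 1)) = msize ?m"
        using msize_add_axis[of "?m - axis k 1" k] diff_axis_add_axis[of ?m k] by simp
      then show ?thesis using less[of "?m - axis k 1"] size False by auto
    qed auto
    then obtain Q where Q: "\<And>k. ?m $ k > 0 \<Longrightarrow> monic_type_II (?m - axis k 1) (Q k)"
        "\<And>k. ?m $ k = 0 \<Longrightarrow> Q k = 0"
      by metis
    show ?thesis using monic_type_II_step[OF P Q, of i] n by auto
  qed
qed

lemma monic_type_II_mop: "monic_type_II n (mop \<mu> n)"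
  unfolding mop_def monic_type_II_def[symmetric]
  by (rule theI') (use monic_type_II_exists monic_type_II_unique in blast)

lemma mop_eqI: "monic_type_II n P \<Longrightarrow> mop \<mu> n = P"
  using monic_type_II_mop monic_type_II_unique by blast

section \<open>The nearest-neighbour recurrence\<close>

lemma nn_recurrence_exists: "\<exists>a b. nn_recurrence \<mu> a b"
proof -
  let ?a = "\<lambda>n. a_ratio n (mop \<mu> n) (mop_down \<mu> n)"
  \<comment> \<open>By uniqueness the polynomial built in the step lemma is \<open>mop\<close> at
    the next index, so its construction is itself the recurrence.\<close>
  have "\<exists>b. mop \<mu> (n + axis i 1) = pCons 0 (mop \<mu> n) - smult (?a n 1) (mop_down \<mu> n 1)
      - smult (?a n 2) (mop_down \<mu> n 2) - smult b (mop \<mu> n)" for n i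
    using monic_type_II_step[OF monic_type_II_mop, of n "mop_down \<mu> n" i]
      mop_eqI
    by (metis (no_types, lifting) mop_down_def monic_type_II_mop neq0_conv)
  then obtain b where b: "\<And>n i. mop \<mu> (n + axis i 1) = pCons 0 (mop \<mu> n)
      - smult (?a n 1) (mop_down \<mu> n 1) - smult (?a n 2) (mop_down \<mu> n 2) - smult (b n i) (mop \<mu> n)"
    by metis
  have "nn_recurrence \<mu> ?a b"
    unfolding nn_recurrence_def b by (auto simp: a_ratio_def)
  then show ?thesis by blast
qed

lemma nn_recurrence_rec: "nn_recurrence \<mu> (rec_a \<mu>) (rec_b \<mu>)"
  using someI_ex[of "\<lambda>ab. nn_recurrence \<mu> (fst ab) (snd ab)"] nn_recurrence_exists
  by (auto simp: rec_a_def rec_b_def rec_coeffs_def)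

lemma mop_recurrence:
  "pCons 0 (mop \<mu> n) = mop \<mu> (n + axis i 1) + smult (rec_b \<mu> n i) (mop \<mu> n)
     + smult (rec_a \<mu> n 1) (mop_down \<mu> n 1) + smult (rec_a \<mu> n 2) (mop_down \<mu> n 2)"
  using nn_recurrence_rec unfolding nn_recurrence_def by simp

text \<open>Take the moment of order \<open>n $ k - 1\<close> against measure \<open>k\<close> in
  the recurrence in direction \<open>k\<close>. If the coefficient were zero, every term on the
  right would vanish, whereas the left side is the nonzero next moment of
  \<open>mop \<mu> n\<close>.\<close>

lemma rec_a_nonzero:
  assumes "n $ k > 0"
  shows "rec_a \<mu> n k \<noteq> 0"
proof
  assume a: "rec_a \<mu> n k = 0"
  obtain m where m: "n $ k = Suc m" using assms gr0_implies_Suc by blast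
  have down: "rec_a \<mu> n l * pmoment \<mu> k m (mop_down \<mu> n l) = 0" for l
  proof (cases "l = k \<or> n $ l = 0")
    case False
    then have "pmoment \<mu> k m (mop \<mu> (n - axis l 1)) = 0"
      using m by (intro monic_type_II_D(3)[OF monic_type_II_mop]) (auto simp: axis_one_nth)
    then show ?thesis using False by (simp add: mop_down_def)
  qed (use a in \<open>auto simp: mop_down_def pmoment_simps\<close>)
  have z: "pmoment \<mu> k m (mop \<mu> (n + axis k 1)) = 0" "pmoment \<mu> k m (mop \<mu> n) = 0"
    using m by (intro monic_type_II_D(3)[OF monic_type_II_mop]; simp)+
  have "pmoment \<mu> k (Suc m) (mop \<mu> n) = 0"
    unfolding pmoment_pCons[symmetric] mop_recurrence[of n k] using down[of 1] down[of 2] z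
    by (auto simp: pmoment_simps)
  then show False using monic_type_II_next_moment_nz[OF monic_type_II_mop, of k n] m by simp
qed

end


section \<open>The tree\<close>

lemma Cons_in_verts_iff: "l # Y \<in> verts N \<longleftrightarrow> Y \<in> verts N \<and> endpoint N Y $ l > 0"
  by (auto elim: verts.cases intro: verts.intros)

lemma ch_eq: "Y \<in> verts N \<Longrightarrow> ch N Y = {l. endpoint N Y $ l > 0}"
  by (simp add: ch_def Cons_in_verts_iff)

lemma msize_child: "endpoint N Y $ l > 0 \<Longrightarrow> Suc (msize (endpoint N (l # Y))) = msize (endpoint N Y)"
  using msize_add_axis[of "endpoint N (l # Y)" l] diff_axis_add_axis[of "endpoint N Y" l] by simp

lemma length_vertex_le: "Y \<in> verts N \<Longrightarrow> length Y + msize (endpoint N Y) \<le> msize N"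
proof (induction Y rule: verts.induct)
  case (step Y i)
  then show ?case using msize_child[OF step.hyps(2)] by simp
qed simp

lemma finite_verts: "finite (verts N)"
proof (rule finite_subset)
  show "verts N \<subseteq> {Y. set Y \<subseteq> (UNIV :: 2 set) \<and> length Y \<le> msize N}"
    using length_vertex_le by fastforce
qed (rule finite_lists_length_le, simp)

text \<open>Every vertex other than the root is the child of exactly one vertex.\<close>

lemma sum_verts:
  "(\<Sum>Y\<in>verts N. f Y) = f [] + (\<Sum>Y\<in>verts N. \<Sum>l\<in>ch N Y. f (l # Y))" for f :: "2 list \<Rightarrow> nat"
proof -
  have eq: "verts N - {[]} = (\<lambda>(Y, l). l # Y) ` (SIGMA Y:verts N. ch N Y)"
    by (auto simp: ch_def Cons_in_verts_iff image_iff elim: verts.cases)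
  have "(\<Sum>Y\<in>verts N - {[]}. f Y) = (\<Sum>(Y, l)\<in>(SIGMA Y:verts N. ch N Y). f (l # Y))"
    unfolding eq by (subst sum.reindex) (auto simp: inj_on_def intro!: sum.cong)
  also have "\<dots> = (\<Sum>Y\<in>verts N. \<Sum>l\<in>ch N Y. f (l # Y))"
    by (rule sum.Sigma[symmetric]) (use finite_verts in auto)
  finally show ?thesis using sum.remove[OF finite_verts verts.root, where g = f] by simp
qed

text \<open>
  The size of the endpoint drops by one along every edge, so summing the drops over all edges
  counts the edges.
\<close>

lemma card_verts:
  "card (verts N) = Suc (msize N) + (\<Sum>Y | Y \<in> verts N \<and> card (ch N Y) = 2. msize (endpoint N Y))"
proof -
  let ?s = "\<lambda>Y. msize (endpoint N Y)"
  let ?J = "{Y \<in> verts N. card (ch N Y) = 2}"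
  have "(\<Sum>Y\<in>verts N. card (ch N Y) * ?s Y) = (\<Sum>Y\<in>verts N. \<Sum>l\<in>ch N Y. 1 + ?s (l # Y))"
  proof (rule sum.cong[OF refl])
    fix Y assume "Y \<in> verts N"
    then have "(\<Sum>l\<in>ch N Y. 1 + ?s (l # Y)) = (\<Sum>l\<in>ch N Y. ?s Y)"
      by (intro sum.cong refl) (auto simp: ch_eq msize_child simp del: endpoint.simps)
    then show "card (ch N Y) * ?s Y = (\<Sum>l\<in>ch N Y. 1 + ?s (l # Y))" by simp
  qed
  also have "\<dots> = (\<Sum>Y\<in>verts N. \<Sum>l\<in>ch N Y. 1) + (\<Sum>Y\<in>verts N. \<Sum>l\<in>ch N Y. ?s (l # Y))"
    by (simp only: sum.distrib)
  finally have "(\<Sum>Y\<in>verts N. card (ch N Y) * ?s Y) + 1 + msize N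
      = card (verts N) + (\<Sum>Y\<in>verts N. ?s Y)"
    using sum_verts[where f = "\<lambda>_. 1" and N = N] sum_verts[where f = ?s and N = N] by simp
  \<comment> \<open>A vertex without children ends at the zero index and has size 0, so its factor 0
    may be replaced by 1; a branching vertex contributes its size a second time.\<close>
  moreover have "(\<Sum>Y\<in>verts N. card (ch N Y) * ?s Y)
      = (\<Sum>Y\<in>verts N. ?s Y + (if card (ch N Y) = 2 then ?s Y else 0))"
  proof (rule sum.cong[OF refl])
    fix Y assume Y: "Y \<in> verts N"
    have "card (ch N Y) \<le> 2" using card_mono[of UNIV "ch N Y"] by simp
    moreover have "?s Y = 0" if "card (ch N Y) = 0"
      using that Y by (auto simp: ch_eq msize_def)
    ultimately show "card (ch N Y) * ?s Y = ?s Y + (if card (ch N Y) = 2 then ?s Y else 0)"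
      by (cases "card (ch N Y)") (auto simp: le_Suc_eq numeral_2_eq_2)
  qed
  moreover have "(\<Sum>Y\<in>verts N. if card (ch N Y) = 2 then ?s Y else 0) = (\<Sum>Y\<in>?J. ?s Y)"
    using finite_verts by (simp add: sum.inter_filter)
  ultimately show ?thesis by (simp add: sum.distrib)
qed

lemma subtree_Cons_iff:
  "l # Y \<in> subtree N Z \<longleftrightarrow> l # Y \<in> verts N \<and> (l # Y = Z \<or> Y \<in> subtree N Z)"
  by (auto simp: subtree_def suffix_Cons Cons_in_verts_iff)

lemma not_in_subtree_shorter: "length Y < length Z \<Longrightarrow> Y \<notin> subtree N Z"
  by (auto simp: subtree_def dest: suffix_length_le)

lemma subtree_same_length: "length Y = length Z \<Longrightarrow> Y \<in> subtree N Z \<longleftrightarrow> Y = Z \<and> Y \<in> verts N"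
  by (auto simp: subtree_def suffix_def)

section \<open>The Jacobi matrix applied to the polynomials on the tree\<close>

lemma cpoly_simps:
  "cpoly 0 z = 0" "cpoly (P + Q) z = cpoly P z + cpoly Q z"
  "cpoly (smult c P) z = of_real c * cpoly P z" "cpoly (pCons 0 P) z = z * cpoly P z"
proof -
  have "map_poly of_real (P + Q) = map_poly of_real P + (map_poly of_real Q :: complex poly)"
    by (rule poly_eqI) (simp add: coeff_map_poly)
  then show "cpoly (P + Q) z = cpoly P z + cpoly Q z" by (simp add: cpoly_def)
  have "map_poly of_real (smult c P) = smult (of_real c) (map_poly of_real P :: complex poly)"
    by (rule poly_eqI) (simp add: coeff_map_poly)
  then show "cpoly (smult c P) z = of_real c * cpoly P z" by (simp add: cpoly_def)
qed (simp_all add: cpoly_def map_poly_pCons)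

lemma m_coeff_Nil: "m_coeff \<mu> N [] = 1"
  by (simp add: m_coeff_def)

lemma m_coeff_Cons: "m_coeff \<mu> N (i # Y) = m_coeff \<mu> N Y / sqrt (W_coeff \<mu> N (i # Y))"
proof -
  have "{Z. suffix Z (i # Y)} = insert (i # Y) {Z. suffix Z Y}"
    by (auto simp: suffix_Cons)
  moreover have "finite {Z. suffix Z Y}" by (simp flip: set_suffixes_eq)
  moreover have "\<not> suffix (i # Y) Y" by (auto dest: suffix_length_le)
  ultimately show ?thesis by (simp add: m_coeff_def)
qed

lemma jacobi_add: "jacobi \<mu> \<kappa> N (f + g) = jacobi \<mu> \<kappa> N f + jacobi \<mu> \<kappa> N g"
  by (auto simp: jacobi_def fun_eq_iff ext_parent_def algebra_simps sum.distrib split: option.split)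

lemma jacobi_scale: "jacobi \<mu> \<kappa> N (scale_fun c f) = scale_fun c (jacobi \<mu> \<kappa> N f)"
  by (auto simp: jacobi_def fun_eq_iff scale_fun_def ext_parent_def algebra_simps sum_distrib_left
      split: option.split)

context perfect_measures
begin

lemma W_coeff_pos: "Y \<in> verts N \<Longrightarrow> W_coeff \<mu> N Y > 0"
  by (cases Y) (auto simp: Cons_in_verts_iff rec_a_nonzero)

lemma m_coeff_pos: "Y \<in> verts N \<Longrightarrow> m_coeff \<mu> N Y > 0"
proof (induction Y rule: verts.induct)
  case (step Y i)
  then have "W_coeff \<mu> N (i # Y) > 0" by (intro W_coeff_pos verts.step)
  then show ?case using step by (simp add: m_coeff_Cons)
qed (simp add: m_coeff_Nil)

lemma sgn_exp_W_coeff: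
  "(- 1) ^ sgn_exp \<mu> N (l # Y) * W_coeff \<mu> N (l # Y) = rec_a \<mu> (endpoint N Y) l"
  by simp

lemma cpoly_mop_recurrence:
  "E * cpoly (mop \<mu> n) E = cpoly (mop \<mu> (n + axis i 1)) E + of_real (rec_b \<mu> n i) * cpoly (mop \<mu> n) E
     + (\<Sum>l\<in>UNIV. of_real (rec_a \<mu> n l) * cpoly (mop_down \<mu> n l) E)"
  unfolding cpoly_simps(4)[symmetric] mop_recurrence[of n i] by (simp add: cpoly_simps sum_2)

text \<open>One square root of the weight is the matrix entry, the other comes from the ratio of the
  \<open>m_coeff\<close> of parent and child; their product with the sign restores
  \<open>rec_a\<close>.\<close>

lemma p_fun_child:
  assumes "l # Y \<in> verts N"
  shows "(- 1) ^ sgn_exp \<mu> N (l # Y) * of_real (sqrt (W_coeff \<mu> N (l # Y))) * p_fun \<mu> N E (l # Y)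
    = of_real (rec_a \<mu> (endpoint N Y) l) * cpoly (mop_down \<mu> (endpoint N Y) l) E / of_real (m_coeff \<mu> N Y)"
proof -
  let ?W = "W_coeff \<mu> N (l # Y)" and ?s = "(- 1) ^ sgn_exp \<mu> N (l # Y) :: complex"
  have W: "?W > 0" using W_coeff_pos[OF assms] .
  have "of_real (sqrt ?W) * of_real (sqrt ?W) = (of_real ?W :: complex)"
    using W by (simp flip: of_real_mult)
  moreover have "?s * of_real ?W = of_real (rec_a \<mu> (endpoint N Y) l)"
    unfolding sgn_exp_W_coeff[symmetric] by simp
  moreover have "p_fun \<mu> N E (l # Y)
      = cpoly (mop_down \<mu> (endpoint N Y) l) E * of_real (sqrt ?W) / of_real (m_coeff \<mu> N Y)"
    using assms by (simp add: p_fun_def m_coeff_Cons mop_down_def Cons_in_verts_iff del: W_coeff.simps)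
  ultimately show ?thesis by (simp del: W_coeff.simps sgn_exp.simps add: mult.assoc)
qed

text \<open>At a vertex other than the root this is the recurrence in the direction of the last
  step, divided by \<open>m_coeff\<close>. At the root both recurrences are averaged with weights
  \<kappa>; the formal parent term has no place in the matrix and remains as the defect.\<close>

lemma jacobi_p_fun:
  assumes Y: "Y \<in> verts N" and \<kappa>: "\<kappa> $ 1 + \<kappa> $ 2 = 1"
  shows "jacobi \<mu> \<kappa> N (p_fun \<mu> N E) Y =
    E * p_fun \<mu> N E Y - (if Y = [] then cpoly (tree_poly \<mu> \<kappa> N None) E else 0)"
proof -
  let ?n = "endpoint N Y" and ?m = "of_real (m_coeff \<mu> N Y) :: complex"
  let ?S = "\<Sum>l\<in>UNIV. of_real (rec_a \<mu> ?n l) * cpoly (mop_down \<mu> ?n l) E"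
  have "(\<Sum>l\<in>ch N Y. (- 1) ^ sgn_exp \<mu> N (l # Y) * of_real (sqrt (W_coeff \<mu> N (l # Y))) * p_fun \<mu> N E (l # Y))
      = (\<Sum>l\<in>ch N Y. of_real (rec_a \<mu> ?n l) * cpoly (mop_down \<mu> ?n l) E / ?m)"
    by (intro sum.cong refl p_fun_child) (simp add: ch_def)
  also have "\<dots> = (\<Sum>l\<in>UNIV. of_real (rec_a \<mu> ?n l) * cpoly (mop_down \<mu> ?n l) E / ?m)"
    \<comment> \<open>Missing children may be added to the sum because \<open>mop_down\<close> is
      zero there.\<close>
    by (rule sum.mono_neutral_left) (use Y in \<open>auto simp: ch_eq mop_down_def cpoly_simps\<close>)
  finally have ch: "(\<Sum>l\<in>ch N Y. (- 1) ^ sgn_exp \<mu> N (l # Y) * of_real (sqrt (W_coeff \<mu> N (l # Y)))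
      * p_fun \<mu> N E (l # Y)) = ?S / ?m"
    by (simp add: sum_divide_distrib)
  show ?thesis
  proof (cases Y)
    case Nil
    have k: "complex_of_real (\<kappa> $ 1) + of_real (\<kappa> $ 2) = 1"
      using \<kappa> by (simp flip: of_real_add)
    let ?r = "\<lambda>i. cpoly (mop \<mu> (N + axis i 1)) E + of_real (rec_b \<mu> N i) * cpoly (mop \<mu> N) E + ?S"
    have "E * cpoly (mop \<mu> N) E = (of_real (\<kappa> $ 1) + of_real (\<kappa> $ 2)) * (E * cpoly (mop \<mu> N) E)"
      by (simp add: k)
    also have "\<dots> = of_real (\<kappa> $ 1) * ?r 1 + of_real (\<kappa> $ 2) * ?r 2"
      unfolding distrib_right using cpoly_mop_recurrence[of E N] Nil by simp
    also have "\<dots> = cpoly (tree_poly \<mu> \<kappa> N None) E + of_real (V_coeff \<mu> \<kappa> N []) * cpoly (mop \<mu> N) E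
        + (of_real (\<kappa> $ 1) + of_real (\<kappa> $ 2)) * ?S"
      by (simp add: tree_poly_def cpoly_simps algebra_simps)
    finally show ?thesis
      using Nil ch verts.root
      by (simp add: jacobi_def k ext_parent_def p_fun_def m_coeff_Nil)
  next
    case (Cons i Y')
    let ?W = "of_real (sqrt (W_coeff \<mu> N Y)) :: complex"
    have Y': "Y' \<in> verts N" "endpoint N Y' $ i > 0" using Y Cons by (auto simp: Cons_in_verts_iff)
    have W: "?W \<noteq> 0" using W_coeff_pos[OF Y] by simp
    have m: "?m = of_real (m_coeff \<mu> N Y') / ?W" using Cons by (simp add: m_coeff_Cons)
    have m0: "?m \<noteq> 0" "complex_of_real (m_coeff \<mu> N Y') \<noteq> 0"
      using m_coeff_pos[OF Y] m_coeff_pos[OF Y'(1)] by simp_all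
    have "?n + axis i 1 = endpoint N Y'" using diff_axis_add_axis[OF Y'(2)] Cons by simp
    then have rec: "E * cpoly (mop \<mu> ?n) E = cpoly (mop \<mu> (endpoint N Y')) E
        + of_real (V_coeff \<mu> \<kappa> N Y) * cpoly (mop \<mu> ?n) E + ?S"
      using cpoly_mop_recurrence[of E ?n i] Cons by simp
    \<comment> \<open>The weight on the edge to the parent converts the normalization of the parent
      into that of \<open>Y\<close>.\<close>
    have "?W * p_fun \<mu> N E Y' = cpoly (mop \<mu> (endpoint N Y')) E / ?m"
      using Y'(1) W m0 by (simp add: p_fun_def m)
    moreover have "p_fun \<mu> N E Y = cpoly (mop \<mu> ?n) E / ?m" using Y by (simp add: p_fun_def)
    ultimately have "jacobi \<mu> \<kappa> N (p_fun \<mu> N E) Y = (of_real (V_coeff \<mu> \<kappa> N Y) * cpoly (mop \<mu> ?n) E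
        + cpoly (mop \<mu> (endpoint N Y')) E + ?S) / ?m"
      using Y Cons ch by (simp add: jacobi_def ext_parent_def add_divide_distrib
          del: V_coeff.simps W_coeff.simps sgn_exp.simps endpoint.simps)
    also have "\<dots> = E * p_fun \<mu> N E Y" using Y rec by (simp add: p_fun_def add.commute)
    finally show ?thesis using Cons by simp
  qed
qed

end


section \<open>Canonical eigenvectors\<close>

locale perfect_tree = perfect_measures +
  fixes \<kappa> :: "real ^ 2" and N :: "nat ^ 2"
  assumes \<kappa>: "\<kappa> $ 1 + \<kappa> $ 2 = 1"
    and card_zeros: "X \<in> Some ` verts N \<union> {None} \<Longrightarrow> card (tree_zeros \<mu> \<kappa> N X) = tree_size N X"
    and disjoint_zeros: "Y \<in> verts N \<Longrightarrow> tree_zeros \<mu> \<kappa> N (Some Y) \<inter> tree_zeros \<mu> \<kappa> N (parent Y) = {}"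
begin

section \<open>Joints and the number of canonical eigenvectors\<close>

definition branchings :: "2 list option set" where
  "branchings = insert None (Some ` {Y \<in> verts N. card (ch N Y) = 2})"

text \<open>Counting the formal parent \<open>None\<close> as a branching makes membership a single
  incidence relation between energies and branchings.\<close>

lemma joint_star_iff:
  "X \<in> joint_star \<mu> \<kappa> N E \<longleftrightarrow> X \<in> branchings \<and> E \<in> tree_zeros \<mu> \<kappa> N X"
  by (cases X) (auto simp: joint_star_def joint_def branchings_def tree_zeros_def tree_poly_def)

lemma energy_set_eq: "energy_set \<mu> \<kappa> N = (\<Union>X\<in>branchings. tree_zeros \<mu> \<kappa> N X)"
  by (auto simp: energy_set_def branchings_def)

lemma finite_branchings: "finite branchings"
  using finite_verts by (simp add: branchings_def)

text \<open>\<open>card\<close> is 0 on infinite sets, so the prescribed number of zeros gives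
  finiteness only once \<open>tree_size\<close> is known to be positive, as it is at a
  branching.\<close>

lemma finite_tree_zeros:
  assumes "X \<in> branchings"
  shows "finite (tree_zeros \<mu> \<kappa> N X)"
proof -
  have "tree_size N X > 0"
  proof (cases X)
    case (Some Y)
    then have Y: "Y \<in> verts N" "card (ch N Y) = 2" using assms by (auto simp: branchings_def)
    then have "ch N Y \<noteq> {}" by auto
    then obtain l where "endpoint N Y $ l > 0" using Y(1) by (auto simp: ch_eq)
    then show ?thesis using msize_child[of N Y l] Some by (simp add: tree_size_def)
  qed (simp add: tree_size_def)
  then show ?thesis using card_zeros[of X] assms by (intro card_ge_0_finite) (auto simp: branchings_def)
qed

lemma finite_energy_set: "finite (energy_set \<mu> \<kappa> N)"
  by (simp add: energy_set_eq finite_branchings finite_tree_zeros)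

lemma finite_joint_star: "finite (joint_star \<mu> \<kappa> N E)"
  by (rule finite_subset[OF _ finite_branchings]) (auto simp: joint_star_iff)

text \<open>Swapping the pairs turns the count by energies into a count of zeros over the
  branchings, which is the sum in \<open>card_verts\<close>.\<close>

lemma card_canonical_index:
  "card (SIGMA E:energy_set \<mu> \<kappa> N. joint_star \<mu> \<kappa> N E) = card (verts N)"
proof -
  let ?J = "{Y \<in> verts N. card (ch N Y) = 2}"
  have "(SIGMA E:energy_set \<mu> \<kappa> N. joint_star \<mu> \<kappa> N E)
      = prod.swap ` (SIGMA X:branchings. tree_zeros \<mu> \<kappa> N X)"
    by (auto simp: joint_star_iff energy_set_eq image_iff)
  then have "card (SIGMA E:energy_set \<mu> \<kappa> N. joint_star \<mu> \<kappa> N E)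
      = (\<Sum>X\<in>branchings. card (tree_zeros \<mu> \<kappa> N X))"
    using finite_branchings finite_tree_zeros by (simp add: card_image card_SigmaI)
  also have "\<dots> = (\<Sum>X\<in>branchings. tree_size N X)"
    by (intro sum.cong refl card_zeros) (auto simp: branchings_def)
  also have "\<dots> = tree_size N None + (\<Sum>Y\<in>?J. tree_size N (Some Y))"
    using finite_verts by (auto simp: branchings_def sum.reindex)
  also have "\<dots> = card (verts N)" by (simp add: card_verts tree_size_def)
  finally show ?thesis .
qed

section \<open>The eigenvalue equation for the canonical vectors\<close>

lemma child_of_joint:
  assumes "X \<in> joint \<mu> N E"
  shows "l # X \<in> verts N" "p_fun \<mu> N E (l # X) \<noteq> 0"
proof -
  have X: "X \<in> verts N" "cpoly (mop \<mu> (endpoint N X)) E = 0" "card (ch N X) = 2"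
    using assms by (auto simp: joint_def)
  then have "ch N X = UNIV" by (intro card_subset_eq) auto
  then show v: "l # X \<in> verts N" by (auto simp: ch_def)
  then have "cpoly (mop \<mu> (endpoint N (l # X))) E \<noteq> 0"
    using disjoint_zeros[OF v] X(2)
    by (auto simp: tree_zeros_def tree_poly_def simp del: endpoint.simps)
  then show "p_fun \<mu> N E (l # X) \<noteq> 0"
    using v m_coeff_pos[OF v] by (simp add: p_fun_def del: endpoint.simps)
qed

lemma p_fun_joint: "X \<in> joint \<mu> N E \<Longrightarrow> p_fun \<mu> N E X = 0"
  by (simp add: joint_def p_fun_def)

lemma branch_fun_outside: "Y \<notin> subtree N Z \<Longrightarrow> branch_fun \<mu> N E Z Y = 0"
  by (simp add: branch_fun_def)

lemma p_fun_root_nonzero: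
  assumes "E \<in> tree_zeros \<mu> \<kappa> N None"
  shows "p_fun \<mu> N E [] \<noteq> 0"
  using disjoint_zeros[OF verts.root] assms verts.root[of N]
  by (auto simp: tree_zeros_def tree_poly_def p_fun_def m_coeff_Nil)

lemma branch_fun_Cons:
  assumes "l # Y \<in> verts N" "l # Y \<noteq> Z"
  shows "branch_fun \<mu> N E Z (l # Y) = branch_fun \<mu> N E Z Y"
  using assms by (simp add: branch_fun_def subtree_Cons_iff indicator_def)

text \<open>The normalization makes each branch contribute exactly 1 to the equation at the joint,
  so the difference of the two branches cancels. The value 0 reflects division by zero.\<close>

lemma branch_fun_self:
  assumes "l # X \<in> verts N"
  shows "(- 1) ^ sgn_exp \<mu> N (l # X) * of_real (sqrt (W_coeff \<mu> N (l # X)))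
    * (p_fun \<mu> N E (l # X) * branch_fun \<mu> N E (l # X) (l # X)) = (if p_fun \<mu> N E (l # X) = 0 then 0 else 1)"
proof -
  have "l # X \<in> subtree N (l # X)" using assms by (simp add: subtree_def)
  then have "branch_fun \<mu> N E (l # X) (l # X) = (- 1) ^ sgn_exp \<mu> N (l # X)
      / (of_real (sqrt (W_coeff \<mu> N (l # X))) * p_fun \<mu> N E (l # X))"
    by (simp add: branch_fun_def)
  moreover have "of_real (sqrt (W_coeff \<mu> N (l # X))) \<noteq> (0 :: complex)"
    using W_coeff_pos[OF assms] by simp
  moreover have "(- 1) ^ sgn_exp \<mu> N (l # X) * (- 1) ^ sgn_exp \<mu> N (l # X) = (1 :: complex)"
    by simp
  ultimately show ?thesis by (simp add: field_simps del: sgn_exp.simps W_coeff.simps)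
qed

text \<open>
  The coefficient of \<open>p(E)\<close> in a canonical eigenvector is locally constant away from the joint,
  and \<open>p(E)\<close> vanishes at the joint, so the eigenvalue equation only has to be checked there.
\<close>

lemma jacobi_b_vec_Some:
  assumes X: "X \<in> joint \<mu> N E"
  shows "jacobi \<mu> \<kappa> N (b_vec \<mu> N E (Some X)) = scale_fun E (b_vec \<mu> N E (Some X))"
proof
  fix Y
  let ?p = "p_fun \<mu> N E" and ?b = "b_vec \<mu> N E (Some X)"
  let ?s = "\<lambda>l. (- 1) ^ sgn_exp \<mu> N (l # Y) * of_real (sqrt (W_coeff \<mu> N (l # Y))) :: complex"
  define g where "g Y = branch_fun \<mu> N E (2 # X) Y - branch_fun \<mu> N E (1 # X) Y" for Y
  have b: "?b Y = ?p Y * g Y" for Y by (simp add: b_vec_def g_def)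
  note child = child_of_joint[OF X]
  show "jacobi \<mu> \<kappa> N ?b Y = scale_fun E ?b Y"
  proof (cases "Y \<in> verts N")
    case False
    then show ?thesis by (simp add: jacobi_def scale_fun_def b p_fun_def)
  next
    case Y: True
    have g_Cons: "g (l # Z) = g Z" if "l # Z \<in> verts N" "Z \<noteq> X" for l Z
      using that by (simp add: g_def branch_fun_Cons)
    \<comment> \<open>The factor \<open>g\<close> can jump only across an edge from \<open>X\<close>
      to a child, where the parent value of \<open>p_fun\<close> is zero anyway.\<close>
    have parent: "ext_parent ?b (parent Y) = g Y * ext_parent ?p (parent Y)"
    proof (cases Y)
      case (Cons l Z)
      then show ?thesis
        using g_Cons[of l Z] Y p_fun_joint[OF X] by (cases "Z = X") (auto simp: ext_parent_def b)
    qed (simp add: ext_parent_def)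
    have children: "(\<Sum>l\<in>ch N Y. ?s l * ?b (l # Y)) = g Y * (\<Sum>l\<in>ch N Y. ?s l * ?p (l # Y))"
      if "Y \<noteq> X"
      unfolding sum_distrib_left
      by (rule sum.cong) (use that g_Cons in \<open>auto simp: ch_def b\<close>)
    have g_short: "g Z = 0" if "length Z \<le> length X" for Z
      using that by (simp add: g_def branch_fun_outside not_in_subtree_shorter)
    show ?thesis
    proof (cases "Y = X")
      case True
      have "ch N X = UNIV" using child(1) by (auto simp: ch_def)
      moreover have "branch_fun \<mu> N E (i # X) (j # X) = 0" if "i \<noteq> j" for i j
        using that by (simp add: branch_fun_outside subtree_same_length)
      ultimately have "(\<Sum>l\<in>ch N X. (- 1) ^ sgn_exp \<mu> N (l # X)
          * of_real (sqrt (W_coeff \<mu> N (l # X))) * ?b (l # X)) = 0"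
        using branch_fun_self[OF child(1), of 1 E] branch_fun_self[OF child(1), of 2 E] child(2)
        by (simp add: sum_2 b g_def del: sgn_exp.simps W_coeff.simps)
      then show ?thesis
        using True Y parent g_short[of X] by (simp add: jacobi_def scale_fun_def b)
    next
      case False
      have "jacobi \<mu> \<kappa> N ?b Y = g Y * jacobi \<mu> \<kappa> N ?p Y"
        using Y parent children[OF False] by (simp add: jacobi_def b algebra_simps)
      \<comment> \<open>The root defect of \<open>p_fun\<close> disappears because \<open>g\<close>
        is zero at the root.\<close>
      also have "\<dots> = E * ?b Y"
        using g_short[of "[]"] by (simp add: jacobi_p_fun[OF Y \<kappa>] b)
      finally show ?thesis by (simp add: scale_fun_def)
    qed
  qed
qed

lemma b_vec_in_eigenspace:
  assumes "X \<in> joint_star \<mu> \<kappa> N E"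
  shows "b_vec \<mu> N E X \<in> eigenspace \<mu> \<kappa> N E"
proof -
  have "jacobi \<mu> \<kappa> N (b_vec \<mu> N E X) = scale_fun E (b_vec \<mu> N E X)"
  proof (cases X)
    case None
    have "jacobi \<mu> \<kappa> N (p_fun \<mu> N E) Y = E * p_fun \<mu> N E Y" for Y
    proof (cases "Y \<in> verts N")
      case True
      then show ?thesis using assms None by (simp add: jacobi_p_fun \<kappa> joint_star_iff tree_zeros_def)
    qed (simp add: jacobi_def p_fun_def)
    then show ?thesis using None by (simp add: b_vec_def scale_fun_def fun_eq_iff)
  next
    case (Some X')
    then show ?thesis
      using assms jacobi_b_vec_Some[of X' E] by (auto simp: joint_star_def split: if_splits)
  qed
  then show ?thesis
    by (auto simp: eigenspace_def l2_verts_def b_vec_def p_fun_def split: option.split)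
qed

section \<open>Independence and completeness of the canonical vectors\<close>

definition pivot :: "2 list option \<Rightarrow> 2 list" where
  "pivot X = (case X of None \<Rightarrow> [] | Some Y \<Rightarrow> 1 # Y)"

text \<open>The joint itself cannot serve as pivot, since \<open>p_fun\<close> vanishes there; its
  first child lies in the support and in only one of the two branches.\<close>

lemma b_vec_pivot_nonzero:
  assumes "X \<in> joint_star \<mu> \<kappa> N E"
  shows "b_vec \<mu> N E X (pivot X) \<noteq> 0"
proof (cases X)
  case None
  then show ?thesis
    using assms p_fun_root_nonzero by (simp add: joint_star_iff b_vec_def pivot_def)
next
  case (Some X')
  then have "X' \<in> joint \<mu> N E" using assms by (auto simp: joint_star_def split: if_splits)
  note child = child_of_joint[OF this]
  have "branch_fun \<mu> N E (2 # X') (1 # X') = 0"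
    by (simp add: branch_fun_outside subtree_same_length)
  moreover have "branch_fun \<mu> N E (1 # X') (1 # X') \<noteq> 0"
    using branch_fun_self[OF child(1), of 1 E] child(2)[of 1] by auto
  ultimately show ?thesis using Some child(2) by (simp add: b_vec_def pivot_def)
qed

text \<open>For a joint \<open>X'\<close>, the support starts at depth
  \<open>length (pivot X')\<close>, with the two children of the joint. A shallower pivot misses it,
  and a pivot of equal depth belongs to a different parent.\<close>

lemma b_vec_pivot_eq_0:
  assumes "length (pivot X) \<le> length (pivot X')" "X \<noteq> X'"
  shows "b_vec \<mu> N E X' (pivot X) = 0"
proof (cases X')
  case (Some Y)
  have "pivot X \<notin> subtree N (l # Y)" for l
  proof (cases "length (pivot X) = length (l # Y)")
    case True
    then show ?thesis
      using assms(2) Some by (subst subtree_same_length) (auto simp: pivot_def split: option.splits)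
  next
    case False
    then show ?thesis
      using assms(1) Some by (intro not_in_subtree_shorter) (simp add: pivot_def)
  qed
  then show ?thesis using Some by (simp add: b_vec_def branch_fun_outside)
qed (use assms in \<open>auto simp: pivot_def split: option.splits\<close>)

lemma b_vec_family:
  assumes "(\<Sum>X\<in>joint_star \<mu> \<kappa> N E. scale_fun (c X) (b_vec \<mu> N E X)) = 0"
  shows "\<forall>X\<in>joint_star \<mu> \<kappa> N E. c X = 0"
  by (rule triangular_family[where piv = pivot and rank = "\<lambda>X. length (pivot X)",
        OF finite_joint_star b_vec_pivot_nonzero b_vec_pivot_eq_0 assms])

lemma jacobi_b_vec: "X \<in> joint_star \<mu> \<kappa> N E \<Longrightarrow> jacobi \<mu> \<kappa> N (b_vec \<mu> N E X) = scale_fun E (b_vec \<mu> N E X)"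
  using b_vec_in_eigenspace by (simp add: eigenspace_def)

abbreviation canonical_index :: "(complex \<times> 2 list option) set" where
  "canonical_index \<equiv> SIGMA E:energy_set \<mu> \<kappa> N. joint_star \<mu> \<kappa> N E"

abbreviation canonical :: "complex \<times> 2 list option \<Rightarrow> 2 list \<Rightarrow> complex" where
  "canonical \<equiv> \<lambda>(E, X). b_vec \<mu> N E X"

lemma finite_canonical_index: "finite canonical_index"
  using finite_energy_set finite_joint_star by blast

lemma canonical_family:
  assumes "(\<Sum>p\<in>canonical_index. scale_fun (c p) (canonical p)) = 0"
  shows "\<forall>p\<in>canonical_index. c p = 0"
proof (rule independent_eigenvectors[where T = "jacobi \<mu> \<kappa> N" and v = "b_vec \<mu> N"])
  show "(\<Sum>(E, X)\<in>canonical_index. scale_fun (c (E, X)) (b_vec \<mu> N E X)) = 0"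
    using assms by (simp add: case_prod_beta)
qed (use finite_energy_set finite_joint_star jacobi_add jacobi_scale jacobi_b_vec b_vec_family in auto)

lemma inj_canonical: "inj_on canonical canonical_index"
  by (rule independent_family(1)[OF finite_canonical_index canonical_family])

lemma independent_canonical: "cfun.independent (canonical ` canonical_index)"
  by (rule independent_family(2)[OF finite_canonical_index canonical_family])

lemma b_vec_in_l2: "X \<in> joint_star \<mu> \<kappa> N E \<Longrightarrow> b_vec \<mu> N E X \<in> l2_verts N"
  using b_vec_in_eigenspace by (simp add: eigenspace_def)

text \<open>Independence together with the count of zeros replaces any appeal to symmetry of the
  matrix.\<close>

lemma span_canonical: "cfun.span (canonical ` canonical_index) = l2_verts N"
  unfolding l2_verts_def
proof (rule functions_on_finite_set_span[OF finite_verts independent_canonical])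
  show "canonical ` canonical_index \<subseteq> {f. \<forall>Y. Y \<notin> verts N \<longrightarrow> f Y = 0}"
    using b_vec_in_l2 by (auto simp: l2_verts_def)
  show "card (verts N) \<le> card (canonical ` canonical_index)"
    using card_image[OF inj_canonical] card_canonical_index by simp
qed

lemma l2_expansion:
  assumes "f \<in> l2_verts N"
  obtains c where "f = (\<Sum>p\<in>canonical_index. scale_fun (c p) (canonical p))"
  using span_family[OF finite_canonical_index inj_canonical] assms span_canonical by metis

section \<open>Eigenspaces and the spectrum\<close>

lemma eigenspace_subspace: "cfun.subspace (eigenspace \<mu> \<kappa> N E)"
proof (rule cfun.subspaceI)
  show "0 \<in> eigenspace \<mu> \<kappa> N E"
    using jacobi_scale[of \<mu> \<kappa> N 0 0] by (simp add: eigenspace_def l2_verts_def)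
  fix f g assume "f \<in> eigenspace \<mu> \<kappa> N E" "g \<in> eigenspace \<mu> \<kappa> N E"
  then show "f + g \<in> eigenspace \<mu> \<kappa> N E"
    by (simp only: eigenspace_def l2_verts_def mem_Collect_eq jacobi_add cfun.scale_right_distrib) simp
next
  fix c f assume "f \<in> eigenspace \<mu> \<kappa> N E"
  then show "scale_fun c f \<in> eigenspace \<mu> \<kappa> N E"
    by (simp only: eigenspace_def l2_verts_def mem_Collect_eq jacobi_scale)
      (simp add: scale_fun_def mult.left_commute)
qed

text \<open>An eigenvector is expanded in the canonical basis and the terms are grouped by energy;
  directness of the sum of eigenspaces leaves only the group at \<open>z\<close>. This covers every
  complex \<open>z\<close>: away from the energies both sides are zero.\<close>

lemma eigenspace_eq_span: "eigenspace \<mu> \<kappa> N z = cfun.span (b_vec \<mu> N z ` joint_star \<mu> \<kappa> N z)"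
proof
  show "cfun.span (b_vec \<mu> N z ` joint_star \<mu> \<kappa> N z) \<subseteq> eigenspace \<mu> \<kappa> N z"
    by (rule cfun.span_minimal[OF _ eigenspace_subspace]) (use b_vec_in_eigenspace in blast)
  show "eigenspace \<mu> \<kappa> N z \<subseteq> cfun.span (b_vec \<mu> N z ` joint_star \<mu> \<kappa> N z)"
  proof
    fix f assume f: "f \<in> eigenspace \<mu> \<kappa> N z"
    obtain c where c: "f = (\<Sum>p\<in>canonical_index. scale_fun (c p) (canonical p))"
      using l2_expansion f by (auto simp: eigenspace_def)
    let ?S = "energy_set \<mu> \<kappa> N"
    define u where "u E = (\<Sum>X\<in>joint_star \<mu> \<kappa> N E. scale_fun (c (E, X)) (b_vec \<mu> N E X))" for E
    \<comment> \<open>Moving \<open>f\<close> into the group at \<open>z\<close> turns the expansion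
      into a vanishing sum with one element from each eigenspace.\<close>
    define w where "w E = u E - (if E = z then f else 0)" for E
    have u_span: "u E \<in> cfun.span (b_vec \<mu> N E ` joint_star \<mu> \<kappa> N E)" for E
      unfolding u_def by (intro cfun.span_sum cfun.span_scale cfun.span_base) auto
    have "u E \<in> eigenspace \<mu> \<kappa> N E" for E
      using u_span cfun.span_minimal[OF _ eigenspace_subspace] b_vec_in_eigenspace by blast
    then have w: "w E \<in> eigenspace \<mu> \<kappa> N E" for E
      using f cfun.subspace_diff[OF eigenspace_subspace] by (simp add: w_def)
    have u0: "u E = 0" if "E \<notin> ?S" for E
      unfolding u_def by (rule sum.neutral) (use that in \<open>auto simp: joint_star_iff energy_set_eq\<close>)
    have "sum u ?S = f"
      unfolding c u_def using finite_energy_set finite_joint_star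
      by (simp add: sum.Sigma case_prod_beta)
    moreover have "sum u (insert z ?S) = sum u ?S"
      by (rule sum.mono_neutral_right) (use u0 finite_energy_set in auto)
    ultimately have "sum w (insert z ?S) = 0"
      unfolding w_def sum_subtractf using finite_energy_set by (simp add: sum.delta)
    then have "\<forall>E\<in>insert z ?S. w E = 0"
      using w finite_energy_set
      by (intro sum_of_eigenvectors_eq_0[where T = "jacobi \<mu> \<kappa> N"])
        (auto simp: eigenspace_def jacobi_add jacobi_scale)
    then have "f = u z" by (simp add: w_def)
    then show "f \<in> cfun.span (b_vec \<mu> N z ` joint_star \<mu> \<kappa> N z)" using u_span by simp
  qed
qed

lemma is_basis_eigenspace: "is_basis (b_vec \<mu> N z ` joint_star \<mu> \<kappa> N z) (eigenspace \<mu> \<kappa> N z)"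
  unfolding is_basis_def eigenspace_eq_span
  using independent_family(2)[where v = "b_vec \<mu> N z", OF finite_joint_star b_vec_family] by blast

lemma geom_mult_eq: "geom_mult \<mu> \<kappa> N z = card (joint_star \<mu> \<kappa> N z)"
proof -
  have "inj_on (b_vec \<mu> N z) (joint_star \<mu> \<kappa> N z)"
    by (rule independent_family(1)[OF finite_joint_star b_vec_family])
  then show ?thesis
    using is_basis_eigenspace[of z] cfun.dim_span_eq_card_independent
    by (metis card_image geom_mult_def is_basis_def)
qed

text \<open>At an energy, a canonical eigenvector destroys injectivity. Elsewhere the eigenspace is
  zero, and surjectivity follows by solving in the canonical basis, where the operator is
  diagonal.\<close>

lemma jacobi_spectrum_eq: "jacobi_spectrum \<mu> \<kappa> N = energy_set \<mu> \<kappa> N"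
proof (intro set_eqI iffI)
  fix z
  let ?T = "\<lambda>f. jacobi \<mu> \<kappa> N f - scale_fun z f"
  {
    assume "z \<in> energy_set \<mu> \<kappa> N"
    then obtain X where X: "X \<in> joint_star \<mu> \<kappa> N z" by (auto simp: energy_set_eq joint_star_iff)
    let ?b = "b_vec \<mu> N z X"
    have "?T ?b = ?T 0" using jacobi_b_vec[OF X] jacobi_scale[of \<mu> \<kappa> N 0 0] by simp
    moreover have "?b \<noteq> 0" using b_vec_pivot_nonzero[OF X] by (metis zero_fun_apply)
    moreover have "?b \<in> l2_verts N" "0 \<in> l2_verts N" using b_vec_in_l2[OF X] by (auto simp: l2_verts_def)
    ultimately have "\<not> inj_on ?T (l2_verts N)" unfolding inj_on_def by blast
    then show "z \<in> jacobi_spectrum \<mu> \<kappa> N" by (simp add: jacobi_spectrum_def bij_betw_def)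
  }
  {
    assume spec: "z \<in> jacobi_spectrum \<mu> \<kappa> N"
    show "z \<in> energy_set \<mu> \<kappa> N"
    proof (rule ccontr)
      assume z: "z \<notin> energy_set \<mu> \<kappa> N"
      then have "joint_star \<mu> \<kappa> N z = {}" by (auto simp: energy_set_eq joint_star_iff)
      then have eig0: "eigenspace \<mu> \<kappa> N z = {0}" by (simp add: eigenspace_eq_span)
      have "inj_on ?T (l2_verts N)"
      proof (rule inj_onI)
        fix f g assume fg: "f \<in> l2_verts N" "g \<in> l2_verts N" "?T f = ?T g"
        have "jacobi \<mu> \<kappa> N (f - g) = jacobi \<mu> \<kappa> N f - jacobi \<mu> \<kappa> N g"
          using jacobi_add[of \<mu> \<kappa> N "f - g" g] by (simp add: eq_diff_eq)
        also have "\<dots> = scale_fun z (f - g)"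
          using fg(3) by (simp add: cfun.scale_right_diff_distrib algebra_simps)
        finally have "f - g \<in> eigenspace \<mu> \<kappa> N z"
          using fg(1,2) by (simp add: eigenspace_def l2_verts_def)
        then show "f = g" using eig0 by simp
      qed
      moreover have "?T ` l2_verts N = l2_verts N"
      proof
        show "?T ` l2_verts N \<subseteq> l2_verts N"
          by (auto simp: l2_verts_def jacobi_def scale_fun_def)
        show "l2_verts N \<subseteq> ?T ` l2_verts N"
        proof
          fix f assume "f \<in> l2_verts N"
          then obtain c where c: "f = (\<Sum>p\<in>canonical_index. scale_fun (c p) (canonical p))"
            using l2_expansion by blast
          \<comment> \<open>The preimage divides each coefficient by the shifted eigenvalue
            \<open>fst p - z\<close>, nonzero because \<open>z\<close> is not an energy.\<close>
          define g where "g = (\<Sum>p\<in>canonical_index. scale_fun (c p / (fst p - z)) (canonical p))"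
          have "?T g = (\<Sum>p\<in>canonical_index. ?T (scale_fun (c p / (fst p - z)) (canonical p)))"
            unfolding g_def sum_subtractf cfun.scale_sum_right
              additive_homogeneous_sum[of "jacobi \<mu> \<kappa> N", OF jacobi_add jacobi_scale] ..
          also have "\<dots> = f"
            unfolding c
          proof (rule sum.cong[OF refl])
            fix p assume p: "p \<in> canonical_index"
            then have "jacobi \<mu> \<kappa> N (canonical p) = scale_fun (fst p) (canonical p)"
              using jacobi_b_vec by auto
            then have T: "?T (scale_fun a (canonical p)) = scale_fun (a * fst p - z * a) (canonical p)" for a
              by (simp only: jacobi_scale cfun.scale_scale cfun.scale_left_diff_distrib)
            have "fst p - z \<noteq> 0" using p z by auto
            then have "c p / (fst p - z) * fst p - z * (c p / (fst p - z)) = c p"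
              by (simp add: divide_simps) (simp add: algebra_simps)
            then show "?T (scale_fun (c p / (fst p - z)) (canonical p)) = scale_fun (c p) (canonical p)"
              by (simp only: T)
          qed
          finally have "f = ?T g" by simp
          moreover have "g \<in> l2_verts N"
            unfolding g_def span_canonical[symmetric]
            by (intro cfun.span_sum cfun.span_scale cfun.span_base) auto
          ultimately show "f \<in> ?T ` l2_verts N" by blast
        qed
      qed
      ultimately show False using spec by (simp add: jacobi_spectrum_def bij_betw_def)
    qed
  }
qed

end

theorem theorem1p2p1:
  fixes \<mu> :: "2 \<Rightarrow> real measure" and \<kappa> :: "real ^ 2" and N :: "nat ^ 2"
  assumes "moment_system \<mu>"
    and "perfect_system \<mu>"
    and "\<forall>i. N $ i \<ge> 1"
    and "\<kappa> $ 1 + \<kappa> $ 2 = 1"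
    and "\<forall>X \<in> Some ` verts N \<union> {None}.
           tree_zeros \<mu> \<kappa> N X \<subseteq> \<real> \<and> card (tree_zeros \<mu> \<kappa> N X) = tree_size N X"
    and "\<forall>Y \<in> verts N. tree_zeros \<mu> \<kappa> N (Some Y) \<inter> tree_zeros \<mu> \<kappa> N (parent Y) = {}"
  shows "jacobi_spectrum \<mu> \<kappa> N = energy_set \<mu> \<kappa> N
    \<and> (\<forall>E \<in> jacobi_spectrum \<mu> \<kappa> N.
          is_basis (b_vec \<mu> N E ` joint_star \<mu> \<kappa> N E) (eigenspace \<mu> \<kappa> N E)
        \<and> geom_mult \<mu> \<kappa> N E = card (joint_star \<mu> \<kappa> N E))
    \<and> inj_on (\<lambda>(E, X). b_vec \<mu> N E X) (SIGMA E : jacobi_spectrum \<mu> \<kappa> N. joint_star \<mu> \<kappa> N E)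
    \<and> is_basis ((\<lambda>(E, X). b_vec \<mu> N E X) ` (SIGMA E : jacobi_spectrum \<mu> \<kappa> N. joint_star \<mu> \<kappa> N E))
        (l2_verts N)"
proof -
  interpret perfect_tree \<mu> \<kappa> N
    using assms by unfold_locales auto
  show ?thesis
    using is_basis_eigenspace geom_mult_eq inj_canonical independent_canonical span_canonical
    unfolding jacobi_spectrum_eq is_basis_def by blast
qed

end
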